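(* For every integer $n\ge 1$, the Catalan number $C_n$ is the number of lattice paths consisting of $n+1$ upsteps $(1,1)$ and $n-1$ downsteps $(1,-1)$ (in any order) such that the interior even-numbered vertices all lie strictly above the line joining the initial and terminal points of the path.
   Context: $C_n=\frac{1}{n+1}\binom{2n}{n}$. Paths start at a fixed point, say the origin. The $2n+1$ vertices of such a path are numbered $0,1,\ldots,2n$ from left to right; vertices $0$ and $2n$ are the initial and terminal points and the others are interior. *)

theory Defs
  imports Complex_Main "HOL-Library.Product_Plus"
begin

definition catalan :: "nat \<Rightarrow> real" where
  "catalan n = 1 / (real n + 1) * real ((2 * n) choose n)"

type_synonym point = "int \<times> int"

definition upstep :: point where "upstep = (1, 1)"

definition downstep :: point where "downstep = (1, -1)"

text \<open>A path from the origin is given by its list of step vectors. Since every path considered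
  starts at the origin, distinct step lists are distinct paths.\<close>

definition lattice_paths :: "nat \<Rightarrow> nat \<Rightarrow> point list set" where
  "lattice_paths u d =
     {p. set p \<subseteq> {upstep, downstep} \<and> count_list p upstep = u \<and> count_list p downstep = d}"

definition vertex :: "point list \<Rightarrow> nat \<Rightarrow> point" where
  "vertex p k = sum_list (take k p)"

text \<open>The line through \<open>A\<close> and \<open>B\<close> is not vertical in any use below: a path with at least one step
  ends strictly to the right of its initial point.\<close>

definition strictly_above_line :: "point \<Rightarrow> point \<Rightarrow> point \<Rightarrow> bool" where
  "strictly_above_line A B P \<longleftrightarrow>
     real_of_int (snd P) >
       real_of_int (snd A) +
       real_of_int (snd B - snd A) / real_of_int (fst B - fst A) * real_of_int (fst P - fst A)"

definition even_interior_above :: "point list \<Rightarrow> bool" where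
  "even_interior_above p \<longleftrightarrow>
     (\<forall>k. 0 < k \<and> k < length p \<and> even k \<longrightarrow>
        strictly_above_line (vertex p 0) (vertex p (length p)) (vertex p k))"

end

theory Submission
  imports Defs
begin

text \<open>
  A path with \<open>n + 1\<close> upsteps and \<open>n - 1\<close> downsteps ends at \<open>(2n, 2)\<close>, so over the interior
  abscissas the line joining its endpoints has height strictly between 0 and 2. An even-numbered
  vertex has even height; it therefore lies above the line iff its height is at least 2, that is,
  iff its height is positive. If all interior even vertices have height at least 2, then the odd
  vertices, being at distance one step from an even vertex of height at least 2 (an interior one or
  the terminal point), have height at least 1. So the condition on the path says exactly that it
  stays above the x-axis after its initial point (lemma \<open>even_interior_above_iff_positive\<close>).

  Such paths are counted by the ballot theorem (lemma \<open>ballot\<close>): a fraction \<open>(u - d) / (u + d)\<close> of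
  all paths with \<open>u\<close> upsteps and \<open>d \<le> u\<close> downsteps stays positive. Here this gives
  \<open>binomial(2n, n+1) / n\<close>, which is the Catalan number. The ballot theorem is proved by removing the
  last step.
\<close>

section \<open>Elementary properties of lattice paths\<close>

lemma upstep_neq_downstep [simp]: "upstep \<noteq> downstep" "downstep \<noteq> upstep"
  by (auto simp: upstep_def downstep_def)

lemma sum_list_steps:
  assumes "set p \<subseteq> {upstep, downstep}"
  shows "sum_list p = (int (length p), int (count_list p upstep) - int (count_list p downstep))"
  using assms by (induction p) (auto simp: upstep_def downstep_def zero_prod_def)

lemma length_steps:
  assumes "set p \<subseteq> {upstep, downstep}"
  shows "length p = count_list p upstep + count_list p downstep"
  using assms by (induction p) auto

lemma sum_list_lattice_path:
  assumes "p \<in> lattice_paths u d"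
  shows "sum_list p = (int (u + d), int u - int d)"
  using assms length_steps[of p] sum_list_steps[of p] by (auto simp: lattice_paths_def)

lemma length_lattice_path: "p \<in> lattice_paths u d \<Longrightarrow> length p = u + d"
  using length_steps[of p] by (auto simp: lattice_paths_def)

lemma finite_lattice_paths: "finite (lattice_paths u d)"
proof (rule finite_subset)
  show "lattice_paths u d \<subseteq> {p. set p \<subseteq> {upstep, downstep} \<and> length p = u + d}"
    using length_lattice_path by (auto simp: lattice_paths_def)
qed (simp add: finite_lists_length_eq)

lemma fst_vertex:
  assumes "p \<in> lattice_paths u d" "k \<le> length p"
  shows "fst (vertex p k) = int k"
  using assms sum_list_steps[of "take k p"] set_take_subset[of k p]
  by (force simp: vertex_def lattice_paths_def)

lemma even_height_iff:
  assumes "p \<in> lattice_paths u d" "k \<le> length p"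
  shows "even (snd (vertex p k)) \<longleftrightarrow> even k"
proof -
  have s: "set (take k p) \<subseteq> {upstep, downstep}"
    using assms(1) set_take_subset[of k p] by (auto simp: lattice_paths_def)
  have "k = count_list (take k p) upstep + count_list (take k p) downstep"
    using length_steps[OF s] assms(2) by simp
  moreover have "snd (vertex p k) =
      int (count_list (take k p) upstep) - int (count_list (take k p) downstep)"
    using sum_list_steps[OF s] by (simp add: vertex_def)
  ultimately show ?thesis
    by (metis even_add even_diff even_of_nat of_nat_add)
qed

lemma height_Suc_le:
  assumes "p \<in> lattice_paths u d" "k < length p"
  shows "snd (vertex p (Suc k)) \<le> snd (vertex p k) + 1"
proof -
  have "p ! k \<in> {upstep, downstep}"
    using assms nth_mem[of k p] by (auto simp: lattice_paths_def simp del: nth_mem)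
  then show ?thesis
    using assms(2) by (auto simp: vertex_def take_Suc_conv_app_nth upstep_def downstep_def)
qed

section \<open>The ballot theorem\<close>

definition positive :: "point list \<Rightarrow> bool" where
  "positive p \<longleftrightarrow> (\<forall>k. 0 < k \<and> k \<le> length p \<longrightarrow> 0 < snd (vertex p k))"

definition positive_paths :: "nat \<Rightarrow> nat \<Rightarrow> point list set" where
  "positive_paths u d = {p \<in> lattice_paths u d. positive p}"

lemma finite_positive_paths: "finite (positive_paths u d)"
  using finite_lattice_paths by (simp add: positive_paths_def)

lemma positive_Nil [simp]: "positive []"
  by (simp add: positive_def)

lemma positive_snoc [simp]:
  "positive (p @ [s]) \<longleftrightarrow> positive p \<and> 0 < snd (sum_list p) + snd s"
  by (auto simp: positive_def vertex_def le_Suc_eq)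

lemma lattice_paths_snoc [simp]:
  "p @ [upstep] \<in> lattice_paths u d \<longleftrightarrow> (\<exists>u'. u = Suc u' \<and> p \<in> lattice_paths u' d)"
  "p @ [downstep] \<in> lattice_paths u d \<longleftrightarrow> (\<exists>d'. d = Suc d' \<and> p \<in> lattice_paths u d')"
  by (auto simp: lattice_paths_def)

lemma lattice_path_last_step:
  assumes "p \<in> lattice_paths u d" "u + d > 0"
  obtains q s where "p = q @ [s]" "s = upstep \<or> s = downstep"
proof (cases p rule: rev_cases)
  case Nil
  then show ?thesis using assms length_lattice_path by fastforce
next
  case (snoc q s)
  then show ?thesis using assms that by (auto simp: lattice_paths_def)
qed

lemma positive_paths_empty:
  assumes "u \<le> d" "u + d > 0"
  shows "positive_paths u d = {}"
proof -
  have "\<not> positive p" if p: "p \<in> lattice_paths u d" for p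
  proof -
    have "snd (vertex p (length p)) \<le> 0"
      using sum_list_lattice_path[OF p] assms(1) by (simp add: vertex_def)
    moreover have "0 < length p" using length_lattice_path[OF p] assms(2) by simp
    ultimately show ?thesis by (force simp: positive_def)
  qed
  then show ?thesis by (auto simp: positive_paths_def)
qed

lemma positive_paths_snoc [simp]:
  "p @ [upstep] \<in> positive_paths (Suc u) d \<longleftrightarrow> p \<in> positive_paths u d \<and> d < Suc u"
  "p @ [downstep] \<in> positive_paths u (Suc d) \<longleftrightarrow> p \<in> positive_paths u d \<and> Suc d < u"
  "p @ [downstep] \<notin> positive_paths u 0"
  using sum_list_lattice_path[of p u d]
  by (auto simp: positive_paths_def upstep_def[THEN arg_cong, of snd]
      downstep_def[THEN arg_cong, of snd])

lemma positive_paths_Suc_0: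
  "positive_paths (Suc u) 0 = (\<lambda>p. p @ [upstep]) ` positive_paths u 0" (is "?L = ?R")
proof
  show "?L \<subseteq> ?R"
  proof
    fix p assume p: "p \<in> ?L"
    then have "p \<in> lattice_paths (Suc u) 0" by (simp add: positive_paths_def)
    then obtain q s where "p = q @ [s]" "s = upstep \<or> s = downstep"
      using lattice_path_last_step[of p "Suc u" 0] by (metis add_Suc zero_less_Suc)
    then show "p \<in> ?R" using p by auto
  qed
qed auto

text \<open>Since a path with more upsteps than downsteps ends at positive height, appending
  the last step to a positive path creates no further constraint.\<close>
lemma positive_paths_Suc_Suc:
  assumes "d < u"
  shows "positive_paths (Suc u) (Suc d) =
    (\<lambda>p. p @ [upstep]) ` positive_paths u (Suc d) \<union>
    (\<lambda>p. p @ [downstep]) ` positive_paths (Suc u) d" (is "?L = ?R")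
proof
  show "?L \<subseteq> ?R"
  proof
    fix p assume p: "p \<in> ?L"
    then have "p \<in> lattice_paths (Suc u) (Suc d)" by (simp add: positive_paths_def)
    then obtain q s where "p = q @ [s]" "s = upstep \<or> s = downstep"
      using lattice_path_last_step[of p "Suc u" "Suc d"] by (metis add_Suc zero_less_Suc)
    then show "p \<in> ?R" using p by auto
  qed
qed (use assms in auto)

lemma card_positive_paths_Suc_0: "card (positive_paths (Suc u) 0) = card (positive_paths u 0)"
  unfolding positive_paths_Suc_0 by (rule card_image) (simp add: inj_on_def)

lemma card_positive_paths_Suc_Suc:
  assumes "d < u"
  shows "card (positive_paths (Suc u) (Suc d)) =
    card (positive_paths u (Suc d)) + card (positive_paths (Suc u) d)"
proof -
  have "inj_on (\<lambda>p. p @ [s]) A" for s :: point and A by (simp add: inj_on_def)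
  then show ?thesis
    unfolding positive_paths_Suc_Suc[OF assms]
    by (subst card_Un_disjoint) (auto simp: finite_positive_paths card_image)
qed

text \<open>The product form covers the empty path \<open>u = d = 0\<close> and the paths with \<open>u = d > 0\<close>, which are
  never positive; the latter occur in the recursion.\<close>
lemma ballot:
  assumes "d \<le> u"
  shows "real (u + d) * real (card (positive_paths u d)) =
    (real u - real d) * real ((u + d) choose u)"
  using assms
proof (induction "u + d" arbitrary: u d)
  case 0
  then show ?case by simp
next
  case (Suc m)
  show ?case
  proof (cases "u = d")
    case True
    then show ?thesis using Suc.hyps(2) positive_paths_empty[of u d] by simp
  next
    case False
    then obtain v where u: "u = Suc v" "d \<le> v"
      using Suc.prems by (cases u) auto
    show ?thesis
    proof (cases d)
      case 0
      have "positive_paths 0 0 = {[]}"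
        by (auto simp: positive_paths_def lattice_paths_def dest: length_steps)
      moreover have "real v * real (card (positive_paths v 0)) = real v"
        using Suc.hyps(1)[of v 0] Suc.hyps(2) u 0 by simp
      ultimately have "card (positive_paths v 0) = 1"
        by (cases v) auto
      then show ?thesis using u 0 card_positive_paths_Suc_0 by simp
    next
      case (Suc e)
      define b where "b = real (m choose v)"
      define c where "c = real (m choose Suc v)"
      have m: "m = Suc (v + e)" using Suc.hyps(2) u Suc by simp
      \<comment> \<open>The two counts in the recursion involve \<open>b\<close> and \<open>c\<close>. Multiplying by \<open>v + 1\<close> allows
        everything to be expressed through \<open>b\<close>.\<close>
      have bc: "real (Suc v) * c = real (Suc e) * b"
        using Suc_times_binomial_add[of v e] unfolding b_def c_def m by (metis of_nat_mult)
      have "real m * real (card (positive_paths v (Suc e))) = (real v - real (Suc e)) * b"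
        using Suc.hyps(1)[of v d] u Suc m by (simp add: b_def)
      moreover have "real m * real (card (positive_paths (Suc v) e)) = (real (Suc v) - real e) * c"
        using Suc.hyps(1)[of "Suc v" e] u Suc m by (simp add: c_def)
      ultimately have "real m * real (card (positive_paths u d)) =
          (real v - real (Suc e)) * b + (real (Suc v) - real e) * c"
        using card_positive_paths_Suc_Suc[of e v] u Suc by (simp add: distrib_left)
      then have "real (Suc v) * (real m * real (card (positive_paths u d))) =
          real (Suc v) * ((real v - real (Suc e)) * b + (real (Suc v) - real e) * c)"
        by (simp only:)
      also have "\<dots> = real (Suc v) * (real v - real (Suc e)) * b +
          (real (Suc v) - real e) * (real (Suc v) * c)"
        by (simp only: distrib_left mult.assoc mult.left_commute[of "real (Suc v)"])
      also have "\<dots> = real m * ((real v - real e) * b)"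
        unfolding bc m by (simp add: algebra_simps)
      finally have "real m * (real (Suc v) * real (card (positive_paths u d))) =
          real m * ((real v - real e) * b)"
        by (simp only: mult.left_commute[of "real m"])
      then have "real (Suc v) * real (card (positive_paths u d)) = (real v - real e) * b"
        using m by (simp only: mult_cancel_left) simp
      moreover have "real (Suc v) * real (Suc m choose Suc v) = real (Suc m) * b"
        using Suc_times_binomial[of v m] unfolding b_def by (metis of_nat_mult)
      ultimately have "real (Suc v) * (real (Suc m) * real (card (positive_paths u d))) =
          real (Suc v) * ((real v - real e) * real (Suc m choose Suc v))"
        by (simp only: mult.left_commute[of "real (Suc v)"] mult.left_commute[of "real (Suc m)"])
      then show ?thesis using u Suc m by simp
    qed
  qed
qed

section \<open>The Catalan count\<close>

lemma strictly_above_line_iff: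
  assumes p: "p \<in> lattice_paths (n + 1) (n - 1)"
    and k: "0 < k" "k < length p" "even k"
  shows "strictly_above_line (vertex p 0) (vertex p (length p)) (vertex p k) \<longleftrightarrow>
    0 < snd (vertex p k)"
proof -
  have n: "0 < n" using k length_lattice_path[OF p] by (cases n) auto
  then have len: "length p = 2 * n" using length_lattice_path[OF p] by simp
  define h where "h = snd (vertex p k)"
  have "vertex p (length p) = (int (2 * n), 2)" "vertex p 0 = (0, 0)"
    using sum_list_lattice_path[OF p] n by (auto simp: vertex_def zero_prod_def)
  moreover have "fst (vertex p k) = int k" using fst_vertex[OF p] k by simp
  ultimately have "strictly_above_line (vertex p 0) (vertex p (length p)) (vertex p k) \<longleftrightarrow>
      real k / real n < real_of_int h"
    by (simp add: strictly_above_line_def h_def)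
  also have "\<dots> \<longleftrightarrow> 0 < h"
  proof
    assume "real k / real n < real_of_int h"
    moreover have "0 \<le> real k / real n" by simp
    ultimately show "0 < h" by linarith
  next
    assume "0 < h"
    moreover have "even h" using even_height_iff[OF p] k by (simp add: h_def)
    ultimately have "2 \<le> h" by presburger
    moreover have "real k / real n < 2" using k len n by (simp add: divide_simps)
    ultimately show "real k / real n < real_of_int h" by linarith
  qed
  finally show ?thesis by (simp add: h_def)
qed

lemma even_interior_above_iff_positive:
  assumes n: "1 \<le> n" and p: "p \<in> lattice_paths (n + 1) (n - 1)"
  shows "even_interior_above p \<longleftrightarrow> positive p"
proof
  assume "positive p"
  then show "even_interior_above p"
    using strictly_above_line_iff[OF p] by (auto simp: even_interior_above_def positive_def)
next
  assume above: "even_interior_above p"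
  have len: "length p = 2 * n" using length_lattice_path[OF p] n by simp
  have even_pos: "0 < snd (vertex p k)" if k: "0 < k" "k \<le> length p" "even k" for k
  proof (cases "k = length p")
    case True
    then show ?thesis using sum_list_lattice_path[OF p] n by (simp add: vertex_def)
  next
    case False
    then show ?thesis
      using above k strictly_above_line_iff[OF p] by (auto simp: even_interior_above_def)
  qed
  have "0 < snd (vertex p k)" if k: "0 < k" "k \<le> length p" for k
  proof (cases "even k")
    case True
    then show ?thesis using even_pos k by simp
  next
    case False
    \<comment> \<open>An odd vertex is followed by an even one, because the length is even.\<close>
    then have "Suc k \<le> length p" using k len by (metis Suc_leI dvd_triv_left le_neq_implies_less)
    moreover have "even (Suc k)" using False by simp
    ultimately have "0 < snd (vertex p (Suc k))" "even (snd (vertex p (Suc k)))"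
      using even_pos even_height_iff[OF p] by auto
    then have "2 \<le> snd (vertex p (Suc k))" by presburger
    then show ?thesis using height_Suc_le[OF p, of k] \<open>Suc k \<le> length p\<close> by simp
  qed
  then show "positive p" by (simp add: positive_def)
qed

text \<open>The ballot theorem for \<open>u = n + 1\<close>, \<open>d = n - 1\<close> gives the count \<open>2 / (2n)\<close> times
  \<open>binomial(2n, n+1)\<close>, and \<open>(n + 1) binomial(2n, n+1) = n binomial(2n, n)\<close>.\<close>
theorem mainTheorem3:
  fixes n :: nat
  assumes "n \<ge> 1"
  shows "catalan n = real (card {p \<in> lattice_paths (n + 1) (n - 1). even_interior_above p})"
proof -
  have "{p \<in> lattice_paths (n + 1) (n - 1). even_interior_above p} =
      positive_paths (n + 1) (n - 1)"
    using even_interior_above_iff_positive[OF assms] by (auto simp: positive_paths_def)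
  moreover have "real n * real (card (positive_paths (n + 1) (n - 1))) =
      real (2 * n choose (n + 1))"
  proof -
    have eq: "n + 1 + (n - 1) = 2 * n" and diff: "real (n + 1) - real (n - 1) = 2"
      using assms by (auto simp: of_nat_diff)
    have "n - 1 \<le> n + 1" by simp
    from ballot[OF this, unfolded eq diff] show ?thesis by simp
  qed
  moreover have "real (n + 1) * real (2 * n choose (n + 1)) = real n * real (2 * n choose n)"
  proof -
    have "Suc n * (2 * n choose Suc n) = n * (2 * n choose n)"
      using assms Suc_times_binomial_add[of n "n - 1"] by (simp add: mult_2)
    then show ?thesis by (metis Suc_eq_plus1 of_nat_mult)
  qed
  ultimately have "real n * (real (n + 1) *
      real (card {p \<in> lattice_paths (n + 1) (n - 1). even_interior_above p})) =
      real n * real (2 * n choose n)"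
    by (simp only: mult.left_commute[of "real n"])
  then have "real (n + 1) *
      real (card {p \<in> lattice_paths (n + 1) (n - 1). even_interior_above p}) =
      real (2 * n choose n)"
    using assms by (simp only: mult_cancel_left) simp
  then show ?thesis by (simp add: catalan_def field_simps)
qed

end
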